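(* For every integer $n$, the $n$th Tribonacci sedenion satisfies $$\widehat{T}_n=\frac{\widehat{\alpha}\,\alpha^{n+1}}{(\alpha-\beta)(\alpha-\gamma)}+\frac{\widehat{\beta}\,\beta^{n+1}}{(\beta-\alpha)(\beta-\gamma)}+\frac{\widehat{\gamma}\,\gamma^{n+1}}{(\gamma-\alpha)(\gamma-\beta)},$$ and the $n$th Tribonacci-Lucas sedenion satisfies $$\widehat{K}_n=\widehat{\alpha}\,\alpha^{n}+\widehat{\beta}\,\beta^{n}+\widehat{\gamma}\,\gamma^{n}.$$
   Context: The Tribonacci numbers are $T_n=T_{n-1}+T_{n-2}+T_{n-3}$ with $T_0=0,T_1=1,T_2=1$, and the Tribonacci-Lucas numbers are $K_n=K_{n-1}+K_{n-2}+K_{n-3}$ with $K_0=3,K_1=1,K_2=3$; both are extended to negative indices so that the recurrences hold for all integers $n$. The sedenions $\mathbb{S}$ are the 16-dimensional real Cayley-Dickson algebra (the double of the octonions) with standard basis $e_0,e_1,\dots,e_{15}$, $e_0=1$ the identity; addition and multiplication by scalars are componentwise. For every integer $n$, $\widehat{T}_n=\sum_{s=0}^{15}T_{n+s}e_s$ and $\widehat{K}_n=\sum_{s=0}^{15}K_{n+s}e_s$. The numbers $\alpha,\beta,\gamma\in\mathbb{C}$ are the three (distinct) roots of $x^3-x^2-x-1=0$, and $\widehat{\alpha}=\sum_{s=0}^{15}\alpha^s e_s$, $\widehat{\beta}=\sum_{s=0}^{15}\beta^s e_s$, $\widehat{\gamma}=\sum_{s=0}^{15}\gamma^s e_s$.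 Since $\beta,\gamma$ are non-real, expressions with complex coefficients are taken in the complexification $\mathbb{S}\otimes_{\mathbb{R}}\mathbb{C}$, in which $\mathbb{S}$ is embedded and complex scalars are central. *)

theory Defs
  imports Complex_Main
begin

section \<open>The Cayley-Dickson construction\<close>

text \<open>
  Real algebras with conjugation, not assumed associative or commutative, together with an
  enumeration of a standard basis (meaningful for indices below the dimension). Every
  class instance used here is obtained from the reals by repeated doubling.
\<close>

class cd_algebra = real_vector + times + one +
  fixes conjg :: "'a \<Rightarrow> 'a"
    and cd_dim :: "'a itself \<Rightarrow> nat"
    and cd_basis :: "nat \<Rightarrow> 'a"
  assumes cd_add_mult: "(x + y) * z = x * z + y * z"
    and cd_mult_add: "x * (y + z) = x * y + x * z"
    and cd_scaleR_mult: "scaleR r x * y = scaleR r (x * y)"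
    and cd_mult_scaleR: "x * scaleR r y = scaleR r (x * y)"
    and cd_one_mult: "1 * x = x"
    and cd_mult_one: "x * 1 = x"
    and conjg_add: "conjg (x + y) = conjg x + conjg y"
    and conjg_scaleR: "conjg (scaleR r x) = scaleR r (conjg x)"
    and conjg_one: "conjg 1 = 1"
    and cd_dim_pos: "0 < cd_dim TYPE('a)"
    and cd_basis_0: "cd_basis 0 = 1"

lemma cd_zero_mult: "0 * x = (0::'a::cd_algebra)"
  using cd_scaleR_mult[of 0 0 x] by simp

lemma cd_mult_zero: "x * 0 = (0::'a::cd_algebra)"
  using cd_mult_scaleR[of x 0 0] by simp

lemma conjg_zero: "conjg 0 = (0::'a::cd_algebra)"
  using conjg_scaleR[of 0 0] by simp

lemma cd_diff_mult: "(x - y) * z = x * z - y * (z::'a::cd_algebra)"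
  by (metis cd_add_mult add_diff_cancel diff_add_cancel)

lemma cd_mult_diff: "x * (y - z) = x * y - x * (z::'a::cd_algebra)"
  by (metis cd_mult_add add_diff_cancel diff_add_cancel)

instantiation real :: cd_algebra
begin

definition conjg_real :: "real \<Rightarrow> real" where "conjg_real x = x"
definition cd_dim_real :: "real itself \<Rightarrow> nat" where "cd_dim_real _ = 1"
definition cd_basis_real :: "nat \<Rightarrow> real" where "cd_basis_real _ = 1"

instance
  by standard (auto simp: conjg_real_def cd_dim_real_def cd_basis_real_def algebra_simps)

end

datatype 'a cd = CD (cd_fst: 'a) (cd_snd: 'a)

instantiation cd :: (real_vector) real_vector
begin

definition zero_cd :: "'a cd" where "0 = CD 0 0"
definition plus_cd :: "'a cd \<Rightarrow> 'a cd \<Rightarrow> 'a cd" where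
  "x + y = CD (cd_fst x + cd_fst y) (cd_snd x + cd_snd y)"
definition minus_cd :: "'a cd \<Rightarrow> 'a cd \<Rightarrow> 'a cd" where
  "x - y = CD (cd_fst x - cd_fst y) (cd_snd x - cd_snd y)"
definition uminus_cd :: "'a cd \<Rightarrow> 'a cd" where
  "- x = CD (- cd_fst x) (- cd_snd x)"
definition scaleR_cd :: "real \<Rightarrow> 'a cd \<Rightarrow> 'a cd" where
  "scaleR r x = CD (scaleR r (cd_fst x)) (scaleR r (cd_snd x))"

instance
  by standard
    (auto simp: zero_cd_def plus_cd_def minus_cd_def uminus_cd_def scaleR_cd_def algebra_simps)

end

text \<open>
  The doubling convention is $(a,b)(c,d) = (ac - \bar d b,\ da + b\bar c)$ and
  $\overline{(a,b)} = (\bar a, -b)$. If the old basis is $e_0,\dots,e_{d-1}$, the new one is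
  $(e_0,0),\dots,(e_{d-1},0),(0,e_0),\dots,(0,e_{d-1})$.
\<close>

instantiation cd :: (cd_algebra) cd_algebra
begin

definition one_cd :: "'a cd" where "1 = CD 1 0"
definition times_cd :: "'a cd \<Rightarrow> 'a cd \<Rightarrow> 'a cd" where
  "x * y = CD (cd_fst x * cd_fst y - conjg (cd_snd y) * cd_snd x)
              (cd_snd y * cd_fst x + cd_snd x * conjg (cd_fst y))"
definition conjg_cd :: "'a cd \<Rightarrow> 'a cd" where
  "conjg x = CD (conjg (cd_fst x)) (- cd_snd x)"
definition cd_dim_cd :: "'a cd itself \<Rightarrow> nat" where
  "cd_dim_cd _ = 2 * cd_dim TYPE('a)"
definition cd_basis_cd :: "nat \<Rightarrow> 'a cd" where
  "cd_basis_cd s = (if s < cd_dim TYPE('a) then CD (cd_basis s) 0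
                    else CD 0 (cd_basis (s - cd_dim TYPE('a))))"

instance
  by standard
    (auto simp: one_cd_def times_cd_def conjg_cd_def cd_dim_cd_def cd_basis_cd_def
      plus_cd_def scaleR_cd_def cd_add_mult cd_mult_add cd_scaleR_mult cd_mult_scaleR
      cd_one_mult cd_mult_one cd_zero_mult cd_mult_zero conjg_add conjg_scaleR conjg_one
      conjg_zero cd_dim_pos cd_basis_0 algebra_simps)

end

type_synonym quaternion = "real cd cd"
type_synonym octonion = "quaternion cd"
type_synonym sedenion = "octonion cd"

abbreviation sed_e :: "nat \<Rightarrow> sedenion" where
  "sed_e \<equiv> cd_basis"

lemma sed_e_0: "sed_e 0 = 1"
  by (rule cd_basis_0)

lemma cd_dim_sedenion: "cd_dim TYPE(sedenion) = 16"
  by (simp add: cd_dim_cd_def cd_dim_real_def)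

text \<open>The elements $e_0,\dots,e_{15}$ are a basis: they pick out the sixteen real coordinates.\<close>

lemma sum_sed_e:
  "(\<Sum>s\<le>15. scaleR (c s) (sed_e s)) =
     CD (CD (CD (CD (c 0) (c 1)) (CD (c 2) (c 3))) (CD (CD (c 4) (c 5)) (CD (c 6) (c 7))))
        (CD (CD (CD (c 8) (c 9)) (CD (c 10) (c 11))) (CD (CD (c 12) (c 13)) (CD (c 14) (c 15))))"
proof -
  have "{..15::nat} = {0,1,2,3,4,5,6,7,8,9,10,11,12,13,14,15}"
    by (simp add: set_eq_iff) presburger
  then show ?thesis
    by (simp add: cd_basis_cd_def cd_basis_real_def cd_dim_cd_def cd_dim_real_def
        plus_cd_def scaleR_cd_def zero_cd_def)
qed

section \<open>Complexification\<close>

text \<open>\<open>Cplx x y\<close> stands for $x \otimes 1 + y \otimes i$ in $V \otimes_{\mathbb R} \mathbb C$.\<close>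

datatype 'a complexification = Cplx (Re_part: 'a) (Im_part: 'a)

instantiation complexification :: (real_vector) ab_group_add
begin

definition zero_complexification :: "'a complexification" where "0 = Cplx 0 0"
definition plus_complexification ::
    "'a complexification \<Rightarrow> 'a complexification \<Rightarrow> 'a complexification" where
  "x + y = Cplx (Re_part x + Re_part y) (Im_part x + Im_part y)"
definition minus_complexification ::
    "'a complexification \<Rightarrow> 'a complexification \<Rightarrow> 'a complexification" where
  "x - y = Cplx (Re_part x - Re_part y) (Im_part x - Im_part y)"
definition uminus_complexification :: "'a complexification \<Rightarrow> 'a complexification" where
  "- x = Cplx (- Re_part x) (- Im_part x)"

instance
  by standard
    (auto simp: zero_complexification_def plus_complexification_def
      minus_complexification_def uminus_complexification_def algebra_simps)

end

instantiation complexification :: (cd_algebra) "{one, times}"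
begin

definition one_complexification :: "'a complexification" where "1 = Cplx 1 0"
definition times_complexification ::
    "'a complexification \<Rightarrow> 'a complexification \<Rightarrow> 'a complexification" where
  "x * y = Cplx (Re_part x * Re_part y - Im_part x * Im_part y)
                (Re_part x * Im_part y + Im_part x * Re_part y)"

instance ..

end

definition scaleC ::
    "complex \<Rightarrow> 'a::real_vector complexification \<Rightarrow> 'a complexification"
    (infixr "*\<^sub>C" 75) where
  "c *\<^sub>C x = Cplx (scaleR (Re c) (Re_part x) - scaleR (Im c) (Im_part x))
                 (scaleR (Re c) (Im_part x) + scaleR (Im c) (Re_part x))"

definition complexify :: "'a::real_vector \<Rightarrow> 'a complexification" where
  "complexify x = Cplx x 0"

lemma scaleC_vector_space: "vector_space (scaleC :: _ \<Rightarrow> 'a::real_vector complexification \<Rightarrow> _)"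
  by standard (auto simp: scaleC_def plus_complexification_def algebra_simps)

lemma complexify_scaleR: "complexify (scaleR r x) = of_real r *\<^sub>C complexify x"
  by (simp add: complexify_def scaleC_def)

lemma complexify_mult:
  fixes x y :: "'a::cd_algebra"
  shows "complexify (x * y) = complexify x * complexify y"
  by (simp add: complexify_def times_complexification_def cd_zero_mult cd_mult_zero)

lemma scaleC_mult_left:
  fixes x y :: "'a::cd_algebra complexification"
  shows "(c *\<^sub>C x) * y = c *\<^sub>C (x * y)"
  by (simp add: scaleC_def times_complexification_def cd_add_mult cd_diff_mult
      cd_scaleR_mult algebra_simps)

lemma scaleC_mult_right:
  fixes x y :: "'a::cd_algebra complexification"
  shows "x * (c *\<^sub>C y) = c *\<^sub>C (x * y)"
  by (simp add: scaleC_def times_complexification_def cd_mult_add cd_mult_diff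
      cd_mult_scaleR algebra_simps)

section \<open>Tribonacci and Tribonacci-Lucas sequences and sedenions\<close>

text \<open>
  The two-sided sequence with $V_0=a$, $V_1=b$, $V_2=c$ and
  $V_n = V_{n-1}+V_{n-2}+V_{n-3}$ for all integers $n$; at negative indices the recurrence is
  solved for its last term.
\<close>

function trib_seq :: "int \<Rightarrow> int \<Rightarrow> int \<Rightarrow> int \<Rightarrow> int" where
  "trib_seq a b c n =
     (if n = 0 then a else if n = 1 then b else if n = 2 then c
      else if n > 2 then trib_seq a b c (n - 1) + trib_seq a b c (n - 2) + trib_seq a b c (n - 3)
      else trib_seq a b c (n + 3) - trib_seq a b c (n + 2) - trib_seq a b c (n + 1))"
  by auto
termination
  by (relation "measure (\<lambda>(a, b, c, n). if n < 0 then nat (3 - n) else nat n)") auto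

declare trib_seq.simps [simp del]

lemma trib_seq_initial:
  "trib_seq a b c 0 = a" "trib_seq a b c 1 = b" "trib_seq a b c 2 = c"
  by (simp_all add: trib_seq.simps)

lemma trib_seq_rec:
  "trib_seq a b c n = trib_seq a b c (n - 1) + trib_seq a b c (n - 2) + trib_seq a b c (n - 3)"
proof (cases "n > 2")
  case True
  then show ?thesis by (subst trib_seq.simps) simp
next
  case False
  then show ?thesis
    using trib_seq.simps[of a b c "n - 3"] by simp
qed

definition tribonacci :: "int \<Rightarrow> int" where
  "tribonacci = trib_seq 0 1 1"

definition tribonacci_lucas :: "int \<Rightarrow> int" where
  "tribonacci_lucas = trib_seq 3 1 3"

definition tribonacci_sedenion :: "int \<Rightarrow> sedenion" where
  "tribonacci_sedenion n = (\<Sum>s\<le>15. scaleR (of_int (tribonacci (n + int s))) (sed_e s))"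

definition tribonacci_lucas_sedenion :: "int \<Rightarrow> sedenion" where
  "tribonacci_lucas_sedenion n =
     (\<Sum>s\<le>15. scaleR (of_int (tribonacci_lucas (n + int s))) (sed_e s))"

definition power_sedenion :: "complex \<Rightarrow> sedenion complexification" where
  "power_sedenion z = (\<Sum>s\<le>15. z ^ s *\<^sub>C complexify (sed_e s))"

end

theory Submission
  imports Defs
begin

text \<open>
  Both formulas are Binet formulas, read coordinate by coordinate. A two-sided sequence with the
  Tribonacci recurrence is determined by its values at $0$, $1$, $2$
  (\<open>trib_recurrence_unique\<close>), and for a root $x$ of the characteristic polynomial the sequence
  $x^n$, $n \in \mathbb{Z}$, satisfies that recurrence; so a linear combination of powers of the
  three roots that has the right initial values is the sequence in question
  (\<open>trib_seq_eq_root_powers\<close>).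

  The initial values are symmetric functions of the roots. For the Tribonacci-Lucas numbers they
  are the power sums $p_0, p_1, p_2$. For the Tribonacci numbers they are the divided differences
  of $x$, $x^2$, $x^3$ at the three roots, which are $0$, $1$ and
  $\alpha + \beta + \gamma$. Vieta's relations (\<open>trib_roots_vieta\<close>) evaluate the power sums and the last divided difference.

  The passage to sedenions uses only linearity: since $x^{n+s} = x^n x^s$, the term $c\,x^{n+s}$
  in coordinate $s$ contributes $c\,x^n \sum_s x^s e_s$ (\<open>complexify_sedenion_root_powers\<close>).
\<close>

text \<open>
  Agreement on three consecutive integers propagates in both directions, because the recurrence
  can be solved for its lowest term as well as for its highest.
\<close>

lemma trib_recurrence_unique:
  fixes f g :: "int \<Rightarrow> 'a::ab_group_add"
  assumes f: "\<And>n. f n = f (n - 1) + f (n - 2) + f (n - 3)"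
    and g: "\<And>n. g n = g (n - 1) + g (n - 2) + g (n - 3)"
    and init: "f 0 = g 0" "f 1 = g 1" "f 2 = g 2"
  shows "f n = g n"
proof -
  have "f n = g n \<and> f (n + 1) = g (n + 1) \<and> f (n + 2) = g (n + 2)"
  proof (induction n rule: int_induct[where k = 0])
    case base
    then show ?case using init by simp
  next
    case (step1 i)
    then show ?case using f[of "i + 3"] g[of "i + 3"] by (simp add: algebra_simps)
  next
    case (step2 i)
    have "f (i - 1) = f (i + 2) - f (i + 1) - f i" "g (i - 1) = g (i + 2) - g (i + 1) - g i"
      using f[of "i + 2"] g[of "i + 2"] by (simp_all add: add.commute[of 1])
    then show ?case using step2.IH by (simp add: add.commute[of 1])
  qed
  then show ?thesis by simp
qed

lemma trib_root_powi_rec: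
  fixes x :: "'a::field"
  assumes "x ^ 3 - x ^ 2 - x - 1 = 0"
  shows "x powi n = x powi (n - 1) + x powi (n - 2) + x powi (n - 3)"
proof -
  have "x \<noteq> 0" using assms by auto
  then have shift: "x powi (n - 3 + int k) = x powi (n - 3) * x ^ k" for k
    by (simp add: power_int_add)
  have "x ^ 3 = x ^ 2 + x + 1" using assms by (simp add: algebra_simps)
  then show ?thesis
    using shift[of 3] shift[of 2] shift[of 1] by (simp add: algebra_simps)
qed

lemma trib_seq_eq_root_powers:
  fixes x y z c d e :: complex
  assumes root: "x ^ 3 - x ^ 2 - x - 1 = 0" "y ^ 3 - y ^ 2 - y - 1 = 0"
      "z ^ 3 - z ^ 2 - z - 1 = 0"
    and init: "c + d + e = of_int u" "c * x + d * y + e * z = of_int v"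
      "c * x ^ 2 + d * y ^ 2 + e * z ^ 2 = of_int w"
  shows "of_int (trib_seq u v w n) = c * x powi n + d * y powi n + e * z powi n"
proof (rule trib_recurrence_unique)
  show "of_int (trib_seq u v w m) = (of_int (trib_seq u v w (m - 1))
      + of_int (trib_seq u v w (m - 2)) + of_int (trib_seq u v w (m - 3)) :: complex)" for m
    by (subst trib_seq_rec) simp
  show "c * x powi m + d * y powi m + e * z powi m
      = c * x powi (m - 1) + d * y powi (m - 1) + e * z powi (m - 1)
      + (c * x powi (m - 2) + d * y powi (m - 2) + e * z powi (m - 2))
      + (c * x powi (m - 3) + d * y powi (m - 3) + e * z powi (m - 3))" for m
    by (simp add: trib_root_powi_rec[OF root(1), of m] trib_root_powi_rec[OF root(2), of m]
        trib_root_powi_rec[OF root(3), of m] algebra_simps)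
qed (use init in \<open>simp_all add: trib_seq_initial\<close>)

text \<open>
  With distinct roots, Vieta's relations come out of dividing differences of the equations by
  differences of the roots, without factoring the polynomial.
\<close>

lemma trib_roots_vieta:
  fixes x y z :: "'a::idom"
  assumes root: "x ^ 3 - x ^ 2 - x - 1 = 0" "y ^ 3 - y ^ 2 - y - 1 = 0"
      "z ^ 3 - z ^ 2 - z - 1 = 0"
    and distinct: "x \<noteq> y" "x \<noteq> z" "y \<noteq> z"
  shows "x + y + z = 1" "x * y + y * z + z * x = -1"
proof -
  have "(x - y) * (x^2 + x * y + y^2 - x - y - 1) = 0" using root(1,2) by algebra
  then have xy: "x^2 + x * y + y^2 - x - y - 1 = 0" using distinct(1) by simp
  have "(x - z) * (x^2 + x * z + z^2 - x - z - 1) = 0" using root(1,3) by algebra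
  then have xz: "x^2 + x * z + z^2 - x - z - 1 = 0" using distinct(2) by simp
  have "(y - z) * (x + y + z - 1) = 0" using xy xz by algebra
  then show sum: "x + y + z = 1" using distinct(3) by simp
  show "x * y + y * z + z * x = -1" using xy sum by algebra
qed

text \<open>
  The sums $\sum x^k / ((x-y)(x-z))$ are the second divided differences of $x^k$, that is, the
  complete homogeneous symmetric polynomials of degree $k - 2$ (zero for $k = 1$).
\<close>

lemma divided_differences_powers:
  fixes x y z :: "'a::field"
  assumes "x \<noteq> y" "x \<noteq> z" "y \<noteq> z"
  shows "x / ((x - y) * (x - z)) + y / ((y - x) * (y - z)) + z / ((z - x) * (z - y)) = 0"
    and "x ^ 2 / ((x - y) * (x - z)) + y ^ 2 / ((y - x) * (y - z))
      + z ^ 2 / ((z - x) * (z - y)) = 1"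
    and "x ^ 3 / ((x - y) * (x - z)) + y ^ 3 / ((y - x) * (y - z))
      + z ^ 3 / ((z - x) * (z - y)) = x + y + z"
proof -
  define D where "D = (x - y) * (x - z) * (y - z)"
  have D: "D \<noteq> 0" using assms by (simp add: D_def)
  have common: "a / ((x - y) * (x - z)) + b / ((y - x) * (y - z)) + c / ((z - x) * (z - y))
      = (a * (y - z) - b * (x - z) + c * (x - y)) / D" for a b c
  proof -
    have "a / ((x - y) * (x - z)) = a * (y - z) / D"
      using assms by (simp add: D_def)
    moreover have "b / ((y - x) * (y - z)) = - (b * (x - z)) / D"
      using assms by (simp add: D_def divide_simps) (simp add: algebra_simps)
    moreover have "c / ((z - x) * (z - y)) = c * (x - y) / D"
      using assms by (simp add: D_def divide_simps) (simp add: algebra_simps)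
    ultimately show ?thesis by (simp add: add_divide_distrib diff_divide_distrib)
  qed
  show "x / ((x - y) * (x - z)) + y / ((y - x) * (y - z)) + z / ((z - x) * (z - y)) = 0"
    unfolding common by (simp add: algebra_simps)
  have "x ^ 2 * (y - z) - y ^ 2 * (x - z) + z ^ 2 * (x - y) = D"
    unfolding D_def by algebra
  then show "x ^ 2 / ((x - y) * (x - z)) + y ^ 2 / ((y - x) * (y - z))
      + z ^ 2 / ((z - x) * (z - y)) = 1"
    using D by (simp add: common)
  have "x ^ 3 * (y - z) - y ^ 3 * (x - z) + z ^ 3 * (x - y) = (x + y + z) * D"
    unfolding D_def by algebra
  then show "x ^ 3 / ((x - y) * (x - z)) + y ^ 3 / ((y - x) * (y - z))
      + z ^ 3 / ((z - x) * (z - y)) = x + y + z"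
    using D by (simp add: common)
qed

lemma complexify_sum: "complexify (\<Sum>s\<in>A. f s :: 'b::real_vector) = (\<Sum>s\<in>A. complexify (f s))"
proof (induction A rule: infinite_finite_induct)
  case (insert s A)
  have "complexify (u + v) = complexify u + complexify v" for u v :: 'b
    by (simp add: complexify_def plus_complexification_def)
  then show ?case using insert by simp
qed (simp_all add: complexify_def zero_complexification_def)

text \<open>
  The step from coordinates to sedenions: the scalar identity, taken at $n + s$ for each
  coordinate $s$, assembles to a combination of the power sedenions.
\<close>

lemma complexify_sedenion_root_powers:
  fixes a :: "int \<Rightarrow> int" and x y z c d e :: complex
  assumes binet: "\<And>m. of_int (a m) = c * x powi m + d * y powi m + e * z powi m"
    and nonzero: "x \<noteq> 0" "y \<noteq> 0" "z \<noteq> 0"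
  shows "complexify (\<Sum>s\<le>15. scaleR (of_int (a (n + int s))) (sed_e s)) =
    (c * x powi n) *\<^sub>C power_sedenion x + (d * y powi n) *\<^sub>C power_sedenion y
    + (e * z powi n) *\<^sub>C power_sedenion z"
proof -
  interpret vector_space "scaleC :: complex \<Rightarrow> sedenion complexification \<Rightarrow> _"
    by (rule scaleC_vector_space)
  have coordinate: "complexify (scaleR (of_int (a (n + int s))) (sed_e s)) =
      (c * x powi n) *\<^sub>C x ^ s *\<^sub>C complexify (sed_e s)
      + (d * y powi n) *\<^sub>C y ^ s *\<^sub>C complexify (sed_e s)
      + (e * z powi n) *\<^sub>C z ^ s *\<^sub>C complexify (sed_e s)" for s
    using nonzero
    by (simp add: complexify_scaleR binet power_int_add scale_left_distrib mult.assoc)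
  show ?thesis
    by (simp add: complexify_sum coordinate sum.distrib power_sedenion_def scale_sum_right
        del: scale_scale)
qed

theorem theorem2p1:
  fixes \<alpha> \<beta> \<gamma> :: complex and n :: int
  assumes roots: "{x::complex. x ^ 3 - x ^ 2 - x - 1 = 0} = {\<alpha>, \<beta>, \<gamma>}"
    and distinct_roots: "distinct [\<alpha>, \<beta>, \<gamma>]"
  shows "complexify (tribonacci_sedenion n) =
           (\<alpha> powi (n + 1) / ((\<alpha> - \<beta>) * (\<alpha> - \<gamma>))) *\<^sub>C power_sedenion \<alpha>
         + (\<beta> powi (n + 1) / ((\<beta> - \<alpha>) * (\<beta> - \<gamma>))) *\<^sub>C power_sedenion \<beta>
         + (\<gamma> powi (n + 1) / ((\<gamma> - \<alpha>) * (\<gamma> - \<beta>))) *\<^sub>C power_sedenion \<gamma>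
       \<and> complexify (tribonacci_lucas_sedenion n) =
           (\<alpha> powi n) *\<^sub>C power_sedenion \<alpha>
         + (\<beta> powi n) *\<^sub>C power_sedenion \<beta>
         + (\<gamma> powi n) *\<^sub>C power_sedenion \<gamma>"
proof -
  have root: "\<alpha> ^ 3 - \<alpha> ^ 2 - \<alpha> - 1 = 0" "\<beta> ^ 3 - \<beta> ^ 2 - \<beta> - 1 = 0"
      "\<gamma> ^ 3 - \<gamma> ^ 2 - \<gamma> - 1 = 0"
    using roots by blast+
  have distinct: "\<alpha> \<noteq> \<beta>" "\<alpha> \<noteq> \<gamma>" "\<beta> \<noteq> \<gamma>" using distinct_roots by auto
  have nonzero: "\<alpha> \<noteq> 0" "\<beta> \<noteq> 0" "\<gamma> \<noteq> 0" using root by auto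
  note vieta = trib_roots_vieta[OF root distinct]
  note dd = divided_differences_powers[OF distinct]
  (* The numerators carry exponent n + 1, so the weight of x^n contains one factor x. *)
  define c d e where "c = \<alpha> / ((\<alpha> - \<beta>) * (\<alpha> - \<gamma>))" and "d = \<beta> / ((\<beta> - \<alpha>) * (\<beta> - \<gamma>))"
    and "e = \<gamma> / ((\<gamma> - \<alpha>) * (\<gamma> - \<beta>))"
  have "of_int (tribonacci m) = c * \<alpha> powi m + d * \<beta> powi m + e * \<gamma> powi m" for m
    unfolding tribonacci_def
  proof (rule trib_seq_eq_root_powers[OF root])
    show "c + d + e = of_int 0" using dd(1) by (simp add: c_def d_def e_def)
    show "c * \<alpha> + d * \<beta> + e * \<gamma> = of_int 1"
      using dd(2) by (simp add: c_def d_def e_def power2_eq_square)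
    show "c * \<alpha> ^ 2 + d * \<beta> ^ 2 + e * \<gamma> ^ 2 = of_int 1"
      using dd(3) vieta(1) by (simp add: c_def d_def e_def power2_eq_square power3_eq_cube mult.assoc)
  qed
  then have T: "complexify (tribonacci_sedenion n) = (c * \<alpha> powi n) *\<^sub>C power_sedenion \<alpha>
      + (d * \<beta> powi n) *\<^sub>C power_sedenion \<beta> + (e * \<gamma> powi n) *\<^sub>C power_sedenion \<gamma>"
    unfolding tribonacci_sedenion_def by (rule complexify_sedenion_root_powers[OF _ nonzero])
  have weights: "c * \<alpha> powi n = \<alpha> powi (n + 1) / ((\<alpha> - \<beta>) * (\<alpha> - \<gamma>))"
    "d * \<beta> powi n = \<beta> powi (n + 1) / ((\<beta> - \<alpha>) * (\<beta> - \<gamma>))"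
    "e * \<gamma> powi n = \<gamma> powi (n + 1) / ((\<gamma> - \<alpha>) * (\<gamma> - \<beta>))"
    using nonzero by (simp_all add: c_def d_def e_def power_int_add_1')
  have "of_int (tribonacci_lucas m) = 1 * \<alpha> powi m + 1 * \<beta> powi m + 1 * \<gamma> powi m" for m
    unfolding tribonacci_lucas_def
  proof (rule trib_seq_eq_root_powers[OF root])
    have "\<alpha> ^ 2 + \<beta> ^ 2 + \<gamma> ^ 2 = (\<alpha> + \<beta> + \<gamma>) ^ 2 - 2 * (\<alpha> * \<beta> + \<beta> * \<gamma> + \<gamma> * \<alpha>)" by algebra
    then show "1 * \<alpha> ^ 2 + 1 * \<beta> ^ 2 + 1 * \<gamma> ^ 2 = of_int 3" by (simp add: vieta)
  qed (use vieta(1) in simp_all)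
  then have K: "complexify (tribonacci_lucas_sedenion n) = (1 * \<alpha> powi n) *\<^sub>C power_sedenion \<alpha>
      + (1 * \<beta> powi n) *\<^sub>C power_sedenion \<beta> + (1 * \<gamma> powi n) *\<^sub>C power_sedenion \<gamma>"
    unfolding tribonacci_lucas_sedenion_def by (rule complexify_sedenion_root_powers[OF _ nonzero])
  show ?thesis using T K by (simp add: weights)
qed

end
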